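(* Let $n\ge 4$ and let $QD_{2^n}=\langle a,b : a^{2^{n-1}}=b^2=1,\ bab^{-1}=a^{2^{n-2}-1}\rangle$ be the quasidihedral group of order $2^n$. Then $$\text{L-Spec}(\Gamma_{QD_{2^n}}) = \{0^{2^{n-2}+1},\ (2^{n-1}-2)^{2^{n-1}-3},\ 2^{2^{n-2}}\}$$ and $$\text{Q-Spec}(\Gamma_{QD_{2^n}}) = \{(2^n-6)^1,\ (2^{n-1}-4)^{2^{n-1}-3},\ 2^{2^{n-2}},\ 0^{2^{n-2}}\},$$ where in the last entries of the form $2^{2^{n-2}}$ the eigenvalue is $2$ and its multiplicity is $2^{n-2}$.
   Context: The commuting graph $\Gamma_G$ of a finite non-abelian group $G$ with center $Z(G)$ is the simple undirected graph with vertex set $G\setminus Z(G)$ in which two distinct vertices $x,y$ are adjacent if and only if $xy=yx$. For a finite graph $\mathcal{G}$ with adjacency matrix $A$ and (diagonal) degree matrix $D$, $\text{L-Spec}(\mathcal{G})$ and $\text{Q-Spec}(\mathcal{G})$ denote the multisets of eigenvalues (with multiplicity) of the Laplacian matrix $D-A$ and of the signless Laplacian matrix $D+A$, respectively. The notation $\{\alpha_1^{a_1},\dots,\alpha_l^{a_l}\}$ means the multiset in which $\alpha_i$ is listed $a_i$ times (if listed values coincide, their multiplicities add; an exponent $0$ means the value does not appear). *)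

theory Defs
  imports
    "HOL-Algebra.Coset"
    "Graph_Theory.Pair_Digraph"
    "Jordan_Normal_Form.Char_Poly"
begin

section \<open>Groups given by generators and relations\<close>

datatype 'x letter = Gen 'x | Inv 'x

text \<open>
  All elements of the type \<open>'x\<close> are generators. A pair \<open>(l, r)\<close> in \<open>R\<close> is the relation \<open>l = r\<close>.
  The relation below is the congruence on words that makes \<open>Gen x\<close> and \<open>Inv x\<close>
  mutually inverse and forces the relations in \<open>R\<close>, so its quotient is the free group on \<open>'x\<close>
  modulo the normal closure of all \<open>l r\<^sup>-\<^sup>1\<close>.
\<close>

inductive word_eq :: "('x letter list \<times> 'x letter list) set \<Rightarrow> 'x letter list \<Rightarrow> 'x letter list \<Rightarrow> bool"
  for R where
  refl: "word_eq R w w"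
| sym: "word_eq R v w \<Longrightarrow> word_eq R w v"
| trans: "word_eq R u v \<Longrightarrow> word_eq R v w \<Longrightarrow> word_eq R u w"
| cancel_right: "word_eq R (u @ [Gen x, Inv x] @ v) (u @ v)"
| cancel_left: "word_eq R (u @ [Inv x, Gen x] @ v) (u @ v)"
| relation: "(l, r) \<in> R \<Longrightarrow> word_eq R (u @ l @ v) (u @ r @ v)"

definition word_rel :: "('x letter list \<times> 'x letter list) set \<Rightarrow> 'x letter list rel" where
  "word_rel R = {(v, w). word_eq R v w}"

definition presented_group :: "('x letter list \<times> 'x letter list) set \<Rightarrow> 'x letter list set monoid" where
  "presented_group R =
     \<lparr> carrier = UNIV // word_rel R,
       monoid.mult = (\<lambda>U V. \<Union>u\<in>U. \<Union>v\<in>V. word_rel R `` {u @ v}),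
       monoid.one = word_rel R `` {[]} \<rparr>"

lemma equiv_word_rel: "equiv UNIV (word_rel R)"
  unfolding word_rel_def
  by (rule equivI) (auto simp: refl_on_def sym_def trans_def
      intro: word_eq.refl word_eq.sym word_eq.trans)

lemma word_eq_append_context: "word_eq R v w \<Longrightarrow> word_eq R (p @ v @ q) (p @ w @ q)"
proof (induction rule: word_eq.induct)
  case (cancel_right u x v)
  then show ?case using word_eq.cancel_right[of R "p @ u" x "v @ q"] by simp
next
  case (cancel_left u x v)
  then show ?case using word_eq.cancel_left[of R "p @ u" x "v @ q"] by simp
next
  case (relation l r u v)
  then show ?case using word_eq.relation[of l r R "p @ u" "v @ q"] by simp
qed (blast intro: word_eq.refl word_eq.sym word_eq.trans)+

lemma word_eq_append:
  assumes "word_eq R u u'" and "word_eq R v v'"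
  shows "word_eq R (u @ v) (u' @ v')"
  using word_eq_append_context[OF assms(1), of "[]" v] word_eq_append_context[OF assms(2), of u' "[]"]
  by (auto intro: word_eq.trans)

lemma word_class_eq_iff: "word_rel R `` {v} = word_rel R `` {w} \<longleftrightarrow> word_eq R v w"
  using eq_equiv_class_iff[OF equiv_word_rel, of v w R] by (simp add: word_rel_def)

lemma presented_group_mult:
  "word_rel R `` {u} \<otimes>\<^bsub>presented_group R\<^esub> word_rel R `` {v} = word_rel R `` {u @ v}"
proof -
  have "word_rel R `` {u' @ v'} = word_rel R `` {u @ v}"
    if "u' \<in> word_rel R `` {u}" "v' \<in> word_rel R `` {v}" for u' v'
    using that word_eq_append[of R u u' v v']
    by (simp add: word_class_eq_iff) (simp add: word_rel_def word_eq.sym)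
  moreover have "w \<in> word_rel R `` {w}" for w
    by (simp add: word_rel_def word_eq.refl)
  ultimately have "(\<Union>u'\<in>word_rel R `` {u}. \<Union>v'\<in>word_rel R `` {v}. word_rel R `` {u' @ v'})
      = word_rel R `` {u @ v}"
    by blast
  then show ?thesis by (simp add: presented_group_def)
qed

fun inv_letter :: "'x letter \<Rightarrow> 'x letter" where
  "inv_letter (Gen x) = Inv x"
| "inv_letter (Inv x) = Gen x"

lemma word_eq_inverse: "word_eq R (rev (map inv_letter w) @ w) []"
proof (induction w)
  case Nil
  then show ?case by (simp add: word_eq.refl)
next
  case (Cons a w)
  have "word_eq R (rev (map inv_letter w) @ [inv_letter a, a] @ w) (rev (map inv_letter w) @ w)"
    by (cases a) (simp_all only: inv_letter.simps word_eq.cancel_left word_eq.cancel_right)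
  with Cons show ?case by (auto intro: word_eq.trans)
qed

lemma group_presented_group: "group (presented_group R)"
proof (rule groupI)
  have cls: "\<exists>w. U = word_rel R `` {w}" if "U \<in> carrier (presented_group R)" for U
    using that by (auto simp: presented_group_def quotient_def)
  have in_carrier: "word_rel R `` {w} \<in> carrier (presented_group R)" for w
    by (auto simp: presented_group_def quotient_def)
  have one: "\<one>\<^bsub>presented_group R\<^esub> = word_rel R `` {[]}"
    by (simp add: presented_group_def)
  show "\<one>\<^bsub>presented_group R\<^esub> \<in> carrier (presented_group R)"
    by (simp add: one in_carrier)
  fix U assume "U \<in> carrier (presented_group R)"
  then obtain u where u: "U = word_rel R `` {u}" using cls by blast
  show "\<one>\<^bsub>presented_group R\<^esub> \<otimes>\<^bsub>presented_group R\<^esub> U = U"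
    by (simp add: one u presented_group_mult)
  show "\<exists>V\<in>carrier (presented_group R). V \<otimes>\<^bsub>presented_group R\<^esub> U = \<one>\<^bsub>presented_group R\<^esub>"
    by (rule bexI[OF _ in_carrier[of "rev (map inv_letter u)"]])
       (simp add: one u presented_group_mult word_class_eq_iff word_eq_inverse)
  fix V assume "V \<in> carrier (presented_group R)"
  then obtain v where v: "V = word_rel R `` {v}" using cls by blast
  show "U \<otimes>\<^bsub>presented_group R\<^esub> V \<in> carrier (presented_group R)"
    by (simp add: u v presented_group_mult in_carrier)
  fix W assume "W \<in> carrier (presented_group R)"
  then obtain w where w: "W = word_rel R `` {w}" using cls by blast
  show "U \<otimes>\<^bsub>presented_group R\<^esub> V \<otimes>\<^bsub>presented_group R\<^esub> W
      = U \<otimes>\<^bsub>presented_group R\<^esub> (V \<otimes>\<^bsub>presented_group R\<^esub> W)"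
    by (simp add: u v w presented_group_mult)
qed

datatype qd_gen = QD_a | QD_b

text \<open>The exponents are truncated natural-number expressions; they are meant for \<open>n \<ge> 4\<close>.\<close>

definition quasidihedral_group :: "nat \<Rightarrow> qd_gen letter list set monoid" where
  "quasidihedral_group n = presented_group
     {(replicate (2 ^ (n - 1)) (Gen QD_a), []),
      ([Gen QD_b, Gen QD_b], []),
      ([Gen QD_b, Gen QD_a, Inv QD_b], replicate (2 ^ (n - 2) - 1) (Gen QD_a))}"


section \<open>Commuting graphs\<close>

definition group_center :: "('a, 'm) monoid_scheme \<Rightarrow> 'a set" where
  "group_center G = {z \<in> carrier G. \<forall>x\<in>carrier G. z \<otimes>\<^bsub>G\<^esub> x = x \<otimes>\<^bsub>G\<^esub> z}"

text \<open>Simple undirected graphs are symmetric loop-free pair digraphs (locale \<open>pair_graph\<close>).\<close>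

definition commuting_graph :: "('a, 'm) monoid_scheme \<Rightarrow> 'a pair_pre_digraph" where
  "commuting_graph G =
     \<lparr> pverts = carrier G - group_center G,
       parcs = {(x, y). x \<in> carrier G - group_center G \<and> y \<in> carrier G - group_center G
                        \<and> x \<noteq> y \<and> x \<otimes>\<^bsub>G\<^esub> y = y \<otimes>\<^bsub>G\<^esub> x} \<rparr>"

lemma pair_graph_commuting_graph:
  assumes "finite (carrier G)"
  shows "pair_graph (commuting_graph G)"
proof -
  have "parcs (commuting_graph G) \<subseteq> carrier G \<times> carrier G"
    by (auto simp: commuting_graph_def)
  then have "finite (parcs (commuting_graph G))"
    using assms by (meson finite_SigmaI finite_subset)
  then show ?thesis
    using assms
    by unfold_locales (auto simp: commuting_graph_def symmetric_def sym_def)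
qed


section \<open>Laplacian and signless Laplacian spectra\<close>

text \<open>Matrices of a graph are taken with respect to an enumeration \<open>vs\<close> of its vertices.\<close>

definition adjacency_mat :: "'a pair_pre_digraph \<Rightarrow> 'a list \<Rightarrow> complex mat" where
  "adjacency_mat \<Gamma> vs = mat (length vs) (length vs)
     (\<lambda>(i, j). if (vs ! i, vs ! j) \<in> parcs \<Gamma> then 1 else 0)"

definition degree_mat :: "'a pair_pre_digraph \<Rightarrow> 'a list \<Rightarrow> complex mat" where
  "degree_mat \<Gamma> vs = mat (length vs) (length vs)
     (\<lambda>(i, j). if i = j then of_nat (out_degree (with_proj \<Gamma>) (vs ! i)) else 0)"

definition laplacian_mat :: "'a pair_pre_digraph \<Rightarrow> 'a list \<Rightarrow> complex mat" where
  "laplacian_mat \<Gamma> vs = degree_mat \<Gamma> vs - adjacency_mat \<Gamma> vs"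

definition signless_laplacian_mat :: "'a pair_pre_digraph \<Rightarrow> 'a list \<Rightarrow> complex mat" where
  "signless_laplacian_mat \<Gamma> vs = degree_mat \<Gamma> vs + adjacency_mat \<Gamma> vs"

definition eigenvalue_mset :: "complex mat \<Rightarrow> complex multiset" where
  "eigenvalue_mset A = proots (char_poly A)"

text \<open>
  For finite graphs the arbitrary choice of the enumeration is irrelevant, see
  \<open>L_Spec_eq\<close> and \<open>Q_Spec_eq\<close> below.
\<close>

definition vertex_list :: "'a pair_pre_digraph \<Rightarrow> 'a list" where
  "vertex_list \<Gamma> = (SOME vs. distinct vs \<and> set vs = pverts \<Gamma>)"

definition L_Spec :: "'a pair_pre_digraph \<Rightarrow> complex multiset" where
  "L_Spec \<Gamma> = eigenvalue_mset (laplacian_mat \<Gamma> (vertex_list \<Gamma>))"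

definition Q_Spec :: "'a pair_pre_digraph \<Rightarrow> complex multiset" where
  "Q_Spec \<Gamma> = eigenvalue_mset (signless_laplacian_mat \<Gamma> (vertex_list \<Gamma>))"

lemma char_poly_reorder:
  fixes f :: "'a \<Rightarrow> 'a \<Rightarrow> complex"
  assumes vs: "distinct vs" and ws: "distinct ws" and eq: "set vs = set ws"
  shows "char_poly (mat (length vs) (length vs) (\<lambda>(i, j). f (vs ! i) (vs ! j)))
       = char_poly (mat (length ws) (length ws) (\<lambda>(i, j). f (ws ! i) (ws ! j)))"
proof -
  define m where "m = length vs"
  have m: "length ws = m"
    using vs ws eq by (metis distinct_card m_def)
  define P :: "'a list \<Rightarrow> 'a list \<Rightarrow> complex mat" where
    "P xs ys = mat m m (\<lambda>(i, j). if xs ! i = ys ! j then 1 else 0)" for xs ys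
  define M where "M xs = mat m m (\<lambda>(i, j). f (xs ! i) (xs ! j))" for xs
  have bij: "bij_betw ((!) xs) {..<m} (set vs)" if "xs \<in> {vs, ws}" for xs
    using that vs ws eq m by (auto simp: m_def intro!: bij_betw_nth)
  have reindex: "(\<Sum>k = 0..<m. g (xs ! k)) = sum g (set vs)" if "xs \<in> {vs, ws}" for xs and g :: "'a \<Rightarrow> complex"
    using sum.reindex_bij_betw[OF bij[OF that], of g] by (simp add: atLeast0LessThan)
  have nth_in: "xs ! i \<in> set vs" if "xs \<in> {vs, ws}" "i < m" for xs i
    using bij_betwE[OF bij[OF that(1)]] that(2) by blast
  have PP: "P xs ys * P ys xs = 1\<^sub>m m" if "xs \<in> {vs, ws}" "ys \<in> {vs, ws}" for xs ys
  proof (rule eq_matI)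
    fix i j assume "i < dim_row (1\<^sub>m m :: complex mat)" "j < dim_col (1\<^sub>m m :: complex mat)"
    then have ij: "i < m" "j < m" by auto
    have "(P xs ys * P ys xs) $$ (i, j)
        = (\<Sum>k = 0..<m. (if xs ! i = ys ! k then 1 else 0) * (if ys ! k = xs ! j then 1 else 0))"
      using ij by (simp add: P_def scalar_prod_def)
    also have "\<dots> = (\<Sum>z\<in>set vs. (if xs ! i = z then 1 else 0) * (if z = xs ! j then 1 else 0))"
      using reindex[OF that(2), of "\<lambda>z. (if xs ! i = z then 1 else 0) * (if z = xs ! j then 1 else 0)"] .
    also have "\<dots> = (\<Sum>z\<in>set vs. if xs ! i = z then (if z = xs ! j then 1 else 0) else 0)"
      by (intro sum.cong) auto
    also have "\<dots> = (if xs ! i = xs ! j then 1 else 0)"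
      using nth_in[OF that(1) ij(1)] by simp
    also have "\<dots> = (if i = j then 1 else 0)"
      using bij[OF that(1)] ij by (auto simp: bij_betw_def inj_on_def)
    finally show "(P xs ys * P ys xs) $$ (i, j) = 1\<^sub>m m $$ (i, j)"
      using ij by simp
  qed (auto simp: P_def)
  have PM: "P vs ws * M ws = mat m m (\<lambda>(i, j). f (vs ! i) (ws ! j))"
  proof (rule eq_matI)
    fix i j
    assume "i < dim_row (mat m m (\<lambda>(i, j). f (vs ! i) (ws ! j)))"
      and "j < dim_col (mat m m (\<lambda>(i, j). f (vs ! i) (ws ! j)))"
    then have ij: "i < m" "j < m" by auto
    have "(P vs ws * M ws) $$ (i, j)
        = (\<Sum>k = 0..<m. (if vs ! i = ws ! k then 1 else 0) * f (ws ! k) (ws ! j))"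
      using ij by (simp add: P_def M_def scalar_prod_def)
    also have "\<dots> = (\<Sum>z\<in>set vs. (if vs ! i = z then 1 else 0) * f z (ws ! j))"
      using reindex[of ws "\<lambda>z. (if vs ! i = z then 1 else 0) * f z (ws ! j)"] by simp
    also have "\<dots> = (\<Sum>z\<in>set vs. if vs ! i = z then f z (ws ! j) else 0)"
      by (intro sum.cong) auto
    also have "\<dots> = f (vs ! i) (ws ! j)"
      using nth_in[of vs i] ij by simp
    finally show "(P vs ws * M ws) $$ (i, j) = mat m m (\<lambda>(i, j). f (vs ! i) (ws ! j)) $$ (i, j)"
      using ij by simp
  qed (auto simp: P_def M_def)
  have PMP: "M vs = P vs ws * M ws * P ws vs"
  proof (rule eq_matI)
    fix i j
    assume "i < dim_row (P vs ws * M ws * P ws vs)" "j < dim_col (P vs ws * M ws * P ws vs)"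
    then have ij: "i < m" "j < m" by (auto simp: P_def)
    have "(P vs ws * M ws * P ws vs) $$ (i, j)
        = (\<Sum>k = 0..<m. f (vs ! i) (ws ! k) * (if ws ! k = vs ! j then 1 else 0))"
      unfolding PM using ij by (simp add: P_def scalar_prod_def)
    also have "\<dots> = (\<Sum>z\<in>set vs. f (vs ! i) z * (if z = vs ! j then 1 else 0))"
      using reindex[of ws "\<lambda>z. f (vs ! i) z * (if z = vs ! j then 1 else 0)"] by simp
    also have "\<dots> = (\<Sum>z\<in>set vs. if z = vs ! j then f (vs ! i) z else 0)"
      by (intro sum.cong) auto
    also have "\<dots> = f (vs ! i) (vs ! j)"
      using nth_in[of vs j] ij by simp
    finally show "M vs $$ (i, j) = (P vs ws * M ws * P ws vs) $$ (i, j)"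
      using ij by (simp add: M_def)
  qed (auto simp: P_def M_def)
  have "similar_mat_wit (M vs) (M ws) (P vs ws) (P ws vs)"
    unfolding similar_mat_wit_def Let_def
    using PP PMP by (auto simp: M_def P_def)
  then have "char_poly (M vs) = char_poly (M ws)"
    by (intro char_poly_similar) (auto simp: similar_mat_def)
  then show ?thesis
    by (simp add: M_def m m_def)
qed

lemma vertex_list:
  assumes "finite (pverts \<Gamma>)"
  shows "distinct (vertex_list \<Gamma>)" and "set (vertex_list \<Gamma>) = pverts \<Gamma>"
  using someI_ex[of "\<lambda>vs. distinct vs \<and> set vs = pverts \<Gamma>"] finite_distinct_list[OF assms]
  by (auto simp: vertex_list_def)

lemma L_Spec_eq:
  assumes "distinct vs" and "set vs = pverts \<Gamma>"
  shows "L_Spec \<Gamma> = eigenvalue_mset (laplacian_mat \<Gamma> vs)"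
proof -
  define f where "f x y = (if x = y then of_nat (out_degree (with_proj \<Gamma>) x) else 0)
      - (if (x, y) \<in> parcs \<Gamma> then 1 else 0 :: complex)" for x y
  have *: "laplacian_mat \<Gamma> ws = mat (length ws) (length ws) (\<lambda>(i, j). f (ws ! i) (ws ! j))"
    if "distinct ws" for ws
    using that
    by (intro eq_matI)
       (auto simp: laplacian_mat_def degree_mat_def adjacency_mat_def f_def nth_eq_iff_index_eq)
  have "finite (pverts \<Gamma>)" using assms by (metis List.finite_set)
  from vertex_list[OF this] char_poly_reorder[of "vertex_list \<Gamma>" vs f] show ?thesis
    using assms by (simp add: L_Spec_def eigenvalue_mset_def *)
qed

lemma Q_Spec_eq:
  assumes "distinct vs" and "set vs = pverts \<Gamma>"
  shows "Q_Spec \<Gamma> = eigenvalue_mset (signless_laplacian_mat \<Gamma> vs)"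
proof -
  define f where "f x y = (if x = y then of_nat (out_degree (with_proj \<Gamma>) x) else 0)
      + (if (x, y) \<in> parcs \<Gamma> then 1 else 0 :: complex)" for x y
  have *: "signless_laplacian_mat \<Gamma> ws = mat (length ws) (length ws) (\<lambda>(i, j). f (ws ! i) (ws ! j))"
    if "distinct ws" for ws
    using that
    by (intro eq_matI)
       (auto simp: signless_laplacian_mat_def degree_mat_def adjacency_mat_def f_def nth_eq_iff_index_eq)
  have "finite (pverts \<Gamma>)" using assms by (metis List.finite_set)
  from vertex_list[OF this] char_poly_reorder[of "vertex_list \<Gamma>" vs f] show ?thesis
    using assms by (simp add: Q_Spec_def eigenvalue_mset_def *)
qed

end

theory Submission
  imports Defs
begin

text \<open>
  Every element of the quasidihedral group has a unique normal form \<open>a\<^sup>x b\<^sup>e\<close> with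
  \<open>x < 2\<^sup>n\<^sup>-\<^sup>1\<close>: rewriting gives existence, and letting words act on normal forms by left
  multiplication separates them. Put \<open>K = 2\<^sup>n\<^sup>-\<^sup>3\<close>. Since \<open>K\<close> is even, \<open>K - 1\<close> is coprime to
  \<open>2 K\<close>, so \<open>a\<^sup>x\<close> commutes with \<open>a\<^sup>y b\<close> iff \<open>2 K\<close> divides \<open>x\<close>, and \<open>a\<^sup>x b\<close> commutes with
  \<open>a\<^sup>y b\<close> iff \<open>2 K\<close> divides \<open>x - y\<close>. Hence the commuting graph is the disjoint union of one complete
  graph on \<open>4 K - 2\<close> vertices and \<open>2 K\<close> edges, and both matrices are block diagonal with
  blocks of the form \<open>c I + d J\<close>, where \<open>J\<close> is the all-ones matrix.
\<close>

section \<open>Spectra of disjoint unions of cliques\<close>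

text \<open>The block with rows from \<open>vs\<close> and columns from \<open>us\<close> vanishes,
  so the characteristic matrix is block upper triangular and its determinant factors.\<close>

lemma char_poly_append:
  fixes f :: "'a \<Rightarrow> 'a \<Rightarrow> 'b::idom"
  assumes zero: "\<And>x y. x \<in> set vs \<Longrightarrow> y \<in> set us \<Longrightarrow> f x y = 0"
  shows "char_poly (mat (length (us @ vs)) (length (us @ vs)) (\<lambda>(i, j). f ((us @ vs) ! i) ((us @ vs) ! j)))
       = char_poly (mat (length us) (length us) (\<lambda>(i, j). f (us ! i) (us ! j)))
       * char_poly (mat (length vs) (length vs) (\<lambda>(i, j). f (vs ! i) (vs ! j)))"
proof -
  define M where "M ws = mat (length ws) (length ws) (\<lambda>(i, j). f (ws ! i) (ws ! j))" for ws
  define B where "B = mat (length us) (length vs) (\<lambda>(i, j). [:- f (us ! i) (vs ! j):])"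
  have "char_poly_matrix (M (us @ vs)) = four_block_mat (char_poly_matrix (M us)) B
          (0\<^sub>m (length vs) (length us)) (char_poly_matrix (M vs))"
    by (rule eq_matI) (auto simp: char_poly_matrix_def M_def B_def nth_append zero)
  moreover have "char_poly_matrix (M ws) \<in> carrier_mat (length ws) (length ws)" for ws
    by (simp add: M_def)
  ultimately have "char_poly (M (us @ vs)) = char_poly (M us) * char_poly (M vs)"
    unfolding char_poly_def
    by (simp add: det_four_block_mat_lower_left_zero[OF _ _ HOL.refl] B_def)
  then show ?thesis by (simp add: M_def)
qed

lemma eigenvalue_mset_concat:
  fixes f :: "'a \<Rightarrow> 'a \<Rightarrow> complex"
  assumes "distinct (concat Vs)"
    and "\<And>V x y. V \<in> set Vs \<Longrightarrow> x \<in> set V \<Longrightarrow> y \<in> set (concat Vs) - set V \<Longrightarrow> f x y = 0"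
  shows "eigenvalue_mset (mat (length (concat Vs)) (length (concat Vs))
             (\<lambda>(i, j). f (concat Vs ! i) (concat Vs ! j)))
       = (\<Sum>V\<leftarrow>Vs. eigenvalue_mset (mat (length V) (length V) (\<lambda>(i, j). f (V ! i) (V ! j))))"
  using assms
proof (induction Vs)
  case Nil
  have "char_poly (mat 0 0 (\<lambda>(i, j). f ([] ! i) ([] ! j))) = 1"
    by (simp add: char_poly_def char_poly_matrix_def)
  then show ?case by (simp add: eigenvalue_mset_def)
next
  case (Cons V Vs)
  have zero: "f x y = 0" if "x \<in> set (concat Vs)" "y \<in> set V" for x y
  proof -
    from that(1) obtain W where W: "W \<in> set Vs" "x \<in> set W" by auto
    then have "y \<notin> set W" using Cons.prems(1) that(2) by auto
    with W that(2) show ?thesis by (intro Cons.prems(2)[of W]) auto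
  qed
  \<comment> \<open>The rule turning \<open>proots\<close> of a product into a sum needs nonzero
    factors; characteristic polynomials are monic.\<close>
  have nz: "char_poly (mat k k g) \<noteq> (0 :: complex poly)" for k g
    using degree_monic_char_poly[of "mat k k g" k] by auto
  have "distinct (concat Vs)" using Cons.prems(1) by simp
  then have "eigenvalue_mset (mat (length (concat Vs)) (length (concat Vs))
             (\<lambda>(i, j). f (concat Vs ! i) (concat Vs ! j)))
       = (\<Sum>V\<leftarrow>Vs. eigenvalue_mset (mat (length V) (length V) (\<lambda>(i, j). f (V ! i) (V ! j))))"
    by (rule Cons.IH) (auto intro!: Cons.prems(2))
  then show ?case
    using char_poly_append[of "concat Vs" V f] zero
    by (simp add: eigenvalue_mset_def proots_mult nz)
qed

text \<open>In the basis \<open>(1, \<dots>, 1), e\<^sub>1, \<dots>, e\<^sub>k\<close> the matrix \<open>c I + d J\<close> is upper triangular.\<close>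

lemma eigenvalue_mset_scalar_plus_const:
  fixes c d :: complex
  shows "eigenvalue_mset (mat (Suc k) (Suc k) (\<lambda>(i, j). if i = j then c + d else d))
       = {#c + of_nat (Suc k) * d#} + replicate_mset k c"
proof -
  define m where "m = Suc k"
  define M where "M = mat m m (\<lambda>(i, j). if i = j then c + d else d)"
  \<comment> \<open>\<open>M\<close> sends the all-ones vector to \<open>c + m d\<close> times
    itself, and \<open>e_j\<close> to \<open>c e_j\<close> plus \<open>d\<close> times the all-ones
    vector; the columns of \<open>T\<close> hold these coordinates.\<close>
  define T where "T = mat m m (\<lambda>(i, j). if i = j then (if i = 0 then c + of_nat m * d else c)
                                     else if i = 0 then d else 0)"
  \<comment> \<open>The columns of \<open>E 1\<close> are the new basis. Since \<open>E r\<close>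
    adds \<open>r\<close> times row 0 to every other row, \<open>E (- 1)\<close> is its
    inverse.\<close>
  define E :: "complex \<Rightarrow> complex mat" where
    "E r = mat m m (\<lambda>(i, j). (if i = j then 1 else 0) + (if j = 0 then (if i = 0 then 0 else r) else 0))" for r
  have E: "E r \<in> carrier_mat m m" "dim_row (E r) = m" "dim_col (E r) = m"
      and E_entry: "i < m \<Longrightarrow> j < m \<Longrightarrow>
        E r $$ (i, j) = (if i = j then 1 else 0) + (if j = 0 then (if i = 0 then 0 else r) else 0)" for r i j
    by (simp_all add: E_def)
  have E_mult: "(E r * X) $$ (i, j) = X $$ (i, j) + (if i = 0 then 0 else r) * X $$ (0, j)"
    if "i < m" "j < m" "X \<in> carrier_mat m m" for r X i j
  proof -
    have "(E r * X) $$ (i, j) = (\<Sum>k = 0..<m. (if i = k then X $$ (k, j) else 0)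
        + (if k = 0 then (if i = 0 then 0 else r) * X $$ (k, j) else 0))"
      using that by (auto simp: E_def scalar_prod_def distrib_right intro!: sum.cong)
    also have "\<dots> = X $$ (i, j) + (if i = 0 then 0 else r) * X $$ (0, j)"
      using that by (simp add: sum.distrib)
    finally show ?thesis .
  qed
  define P Q where "P = E 1" and "Q = E (- 1)"
  have PQ: "P * Q = 1\<^sub>m m" and QP: "Q * P = 1\<^sub>m m"
    using E by (auto simp: P_def Q_def E_mult E_entry simp del: index_mult_mat(1) intro!: eq_matI)
  have MP: "M * P = P * T"
  proof (rule eq_matI)
    fix i j assume "i < dim_row (P * T)" "j < dim_col (P * T)"
    then have ij: "i < m" "j < m" by (auto simp: P_def E_def T_def)
    have "(P * T) $$ (i, j) = (if j = 0 then c + of_nat m * d else if i = j then c + d else d)"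
      using ij by (simp add: P_def E_mult T_def)
    also have "\<dots> = (M * P) $$ (i, j)"
    proof (cases "j = 0")
      case True
      then have "(M * P) $$ (i, j) = (\<Sum>k = 0..<m. (if i = k then c else 0) + d)"
        using ij by (auto simp: M_def P_def E_def scalar_prod_def intro!: sum.cong)
      then show ?thesis using True ij by (simp add: sum.distrib)
    next
      case False
      then have "(M * P) $$ (i, j) = (\<Sum>k = 0..<m. if k = j then (if i = k then c + d else d) else 0)"
        using ij by (simp add: M_def P_def E_def scalar_prod_def if_distrib[of "\<lambda>x. _ * x"] cong: if_cong)
      then show ?thesis using False ij by simp
    qed
    finally show "(M * P) $$ (i, j) = (P * T) $$ (i, j)" ..
  qed (auto simp: M_def P_def E_def T_def)
  have carrier: "M \<in> carrier_mat m m" "P \<in> carrier_mat m m" "Q \<in> carrier_mat m m" "T \<in> carrier_mat m m"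
    by (simp_all add: M_def P_def Q_def E_def T_def)
  have "M = P * T * Q"
    using MP PQ carrier by (metis assoc_mult_mat right_mult_one_mat)
  then have "similar_mat_wit M T P Q"
    using PQ QP carrier by (simp add: similar_mat_wit_def Let_def)
  then have "similar_mat M T" by (auto simp: similar_mat_def)
  then have "char_poly M = char_poly T" by (rule char_poly_similar)
  also have "\<dots> = (\<Prod>a\<leftarrow>diag_mat T. [:- a, 1:])"
    by (rule char_poly_upper_triangular[OF carrier(4)]) (auto simp: T_def)
  also have "diag_mat T = (c + of_nat m * d) # replicate k c"
    by (rule nth_equalityI) (auto simp: diag_mat_def T_def m_def nth_Cons simp del: upt_Suc split: nat.splits)
  finally have "char_poly M = [:- (c + of_nat m * d), 1:] * [:- c, 1:] ^ k" by simp
  then have "eigenvalue_mset M = proots [:- (c + of_nat m * d), 1:] + proots ([:- c, 1:] ^ k)"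
    unfolding eigenvalue_mset_def by (simp only:) (rule proots_mult, simp_all)
  then show ?thesis
    by (simp add: M_def m_def proots_power del: of_nat_Suc)
qed

section \<open>Degrees and spectra of disjoint unions of cliques\<close>

lemma distinct_concat_block_unique:
  "distinct (concat Vs) \<Longrightarrow> V \<in> set Vs \<Longrightarrow> W \<in> set Vs \<Longrightarrow> x \<in> set V \<Longrightarrow> x \<in> set W \<Longrightarrow> V = W"
  by (induction Vs) auto

lemma distinct_concat_block: "distinct (concat Vs) \<Longrightarrow> V \<in> set Vs \<Longrightarrow> distinct V"
  by (induction Vs) auto

lemma out_degree_disjoint_cliques:
  fixes \<Gamma> :: "'a pair_pre_digraph"
  assumes "distinct (concat Vs)"
    and arcs: "parcs \<Gamma> = {(x, y). x \<noteq> y \<and> (\<exists>V\<in>set Vs. x \<in> set V \<and> y \<in> set V)}"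
    and "V \<in> set Vs" "x \<in> set V"
  shows "out_degree (with_proj \<Gamma>) x = length V - 1"
proof -
  have "W = V" if "W \<in> set Vs" "x \<in> set W" for W
    using assms(1) that(1) assms(3) that(2) assms(4) by (rule distinct_concat_block_unique)
  then have adj: "(x, y) \<in> parcs \<Gamma> \<longleftrightarrow> y \<in> set V - {x}" for y
    using assms(3,4) unfolding arcs by blast
  have "out_arcs (with_proj \<Gamma>) x = Pair x ` (set V - {x})"
  proof (rule Set.set_eqI)
    fix e :: "'a \<times> 'a"
    obtain u v where "e = (u, v)" by (cases e)
    then show "e \<in> out_arcs (with_proj \<Gamma>) x \<longleftrightarrow> e \<in> Pair x ` (set V - {x})"
      using adj[of v] by (cases "u = x") (simp_all add: out_arcs_def image_iff)
  qed
  then have "out_degree (with_proj \<Gamma>) x = card (set V - {x})"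
    by (simp add: out_degree_def card_image inj_on_def)
  moreover have "distinct V"
    using assms(1,3) by (rule distinct_concat_block)
  ultimately show ?thesis
    using assms(4) by (simp add: distinct_card)
qed

text \<open>One parameter covers both matrices: \<open>r = -1\<close> gives the Laplacian,
  \<open>r = 1\<close> the signless Laplacian. A clique on \<open>k + 1\<close> vertices contributes
  the block \<open>(k - r) I + r J\<close>, with eigenvalue
  \<open>k - r + (k + 1) r = (1 + r) k\<close> once and \<open>k - r\<close> another
  \<open>k\<close> times.\<close>

lemma eigenvalue_mset_disjoint_cliques:
  fixes r :: complex
  assumes dist: "distinct (concat Vs)" and ne: "[] \<notin> set Vs"
    and arcs: "parcs \<Gamma> = {(x, y). x \<noteq> y \<and> (\<exists>V\<in>set Vs. x \<in> set V \<and> y \<in> set V)}"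
  shows "eigenvalue_mset (degree_mat \<Gamma> (concat Vs) + r \<cdot>\<^sub>m adjacency_mat \<Gamma> (concat Vs))
    = (\<Sum>V\<leftarrow>Vs. {#(1 + r) * of_nat (length V - 1)#}
                + replicate_mset (length V - 1) (of_nat (length V - 1) - r))"
proof -
  define f where "f x y = (if x = y then of_nat (out_degree (with_proj \<Gamma>) x) else 0)
      + r * (if (x, y) \<in> parcs \<Gamma> then 1 else 0)" for x y
  let ?M = "\<lambda>vs. mat (length vs) (length vs) (\<lambda>(i, j). f (vs ! i) (vs ! j))"
  have "degree_mat \<Gamma> (concat Vs) + r \<cdot>\<^sub>m adjacency_mat \<Gamma> (concat Vs) = ?M (concat Vs)"
    using dist by (intro eq_matI) (auto simp: degree_mat_def adjacency_mat_def f_def nth_eq_iff_index_eq)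
  moreover have "eigenvalue_mset (?M (concat Vs)) = (\<Sum>V\<leftarrow>Vs. eigenvalue_mset (?M V))"
  proof (rule eigenvalue_mset_concat[OF dist])
    fix V x y assume *: "V \<in> set Vs" "x \<in> set V" "y \<in> set (concat Vs) - set V"
    have "W = V" if "W \<in> set Vs" "x \<in> set W" for W
      using dist that(1) *(1) that(2) *(2) by (rule distinct_concat_block_unique)
    then have "(x, y) \<notin> parcs \<Gamma>" using * unfolding arcs by blast
    moreover have "x \<noteq> y" using * by blast
    ultimately show "f x y = 0" by (simp add: f_def)
  qed
  moreover have "eigenvalue_mset (?M V) = {#(1 + r) * of_nat (length V - 1)#}
                + replicate_mset (length V - 1) (of_nat (length V - 1) - r)" if V: "V \<in> set Vs" for V
  proof -
    \<comment> \<open>An empty block has no eigenvalue, whereas the formula always lists one;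
      nonemptiness also keeps \<open>length V - 1\<close> from being truncated.\<close>
    have "V \<noteq> []" using ne V by auto
    then obtain k where k: "length V = Suc k" by (cases V) simp_all
    have "distinct V" using dist V by (rule distinct_concat_block)
    moreover have "(x, y) \<in> parcs \<Gamma> \<longleftrightarrow> x \<noteq> y" if "x \<in> set V" "y \<in> set V" for x y
      using that V unfolding arcs by blast
    then have "f x y = (if x = y then (of_nat k - r) + r else r)" if "x \<in> set V" "y \<in> set V" for x y
      using that out_degree_disjoint_cliques[OF dist arcs V that(1)] by (auto simp: f_def k)
    ultimately have "?M V = mat (Suc k) (Suc k) (\<lambda>(i, j). if i = j then (of_nat k - r) + r else r)"
      by (intro eq_matI) (auto simp: k nth_eq_iff_index_eq)
    then show ?thesis
      by (simp only: eigenvalue_mset_scalar_plus_const k) (simp add: algebra_simps)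
  qed
  ultimately show ?thesis
    by (simp cong: map_cong)
qed

text \<open>For \<open>r = -1\<close> the factor \<open>1 + r\<close> vanishes, so each clique
  contributes one eigenvalue 0, and \<open>k - r\<close> becomes the size of the clique.\<close>

lemma L_Spec_disjoint_cliques:
  assumes "distinct (concat Vs)" and "[] \<notin> set Vs" and verts: "set (concat Vs) = pverts \<Gamma>"
    and "parcs \<Gamma> = {(x, y). x \<noteq> y \<and> (\<exists>V\<in>set Vs. x \<in> set V \<and> y \<in> set V)}"
  shows "L_Spec \<Gamma> = (\<Sum>V\<leftarrow>Vs. {#0#} + replicate_mset (length V - 1) (of_nat (length V)))"
proof -
  have "laplacian_mat \<Gamma> vs = degree_mat \<Gamma> vs + (- 1) \<cdot>\<^sub>m adjacency_mat \<Gamma> vs" for vs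
    by (rule eq_matI) (auto simp: laplacian_mat_def degree_mat_def adjacency_mat_def)
  then have "L_Spec \<Gamma> = (\<Sum>V\<leftarrow>Vs. {#(1 + - 1) * of_nat (length V - 1)#}
                + replicate_mset (length V - 1) (of_nat (length V - 1) - - 1))"
    unfolding L_Spec_eq[OF assms(1) verts]
    by (simp only: eigenvalue_mset_disjoint_cliques[OF assms(1,2,4)])
  also have "\<dots> = (\<Sum>V\<leftarrow>Vs. {#0#} + replicate_mset (length V - 1) (of_nat (length V)))"
  proof (intro arg_cong[where f = sum_list] map_cong HOL.refl)
    fix V assume "V \<in> set Vs"
    then have "V \<noteq> []" using assms(2) by auto
    then obtain k where "length V = Suc k" by (cases V) simp_all
    then show "{#(1 + - 1) * of_nat (length V - 1)#}
          + replicate_mset (length V - 1) (of_nat (length V - 1) - - 1 :: complex)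
        = {#0#} + replicate_mset (length V - 1) (of_nat (length V))"
      by (simp add: add.commute)
  qed
  finally show ?thesis .
qed

lemma Q_Spec_disjoint_cliques:
  assumes "distinct (concat Vs)" and "[] \<notin> set Vs" and verts: "set (concat Vs) = pverts \<Gamma>"
    and "parcs \<Gamma> = {(x, y). x \<noteq> y \<and> (\<exists>V\<in>set Vs. x \<in> set V \<and> y \<in> set V)}"
  shows "Q_Spec \<Gamma> = (\<Sum>V\<leftarrow>Vs. {#2 * of_nat (length V - 1)#}
                + replicate_mset (length V - 1) (of_nat (length V - 1) - 1))"
proof -
  have "signless_laplacian_mat \<Gamma> vs = degree_mat \<Gamma> vs + 1 \<cdot>\<^sub>m adjacency_mat \<Gamma> vs" for vs
    by (rule eq_matI) (auto simp: signless_laplacian_mat_def degree_mat_def adjacency_mat_def)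
  then show ?thesis
    unfolding Q_Spec_eq[OF assms(1) verts]
    by (simp only: eigenvalue_mset_disjoint_cliques[OF assms(1,2,4)]) simp
qed

section \<open>Normal forms in the presented group\<close>

text \<open>The values \<open>N = 2 ^ (n - 1)\<close> and \<open>s = 2 ^ (n - 2) - 1\<close> give
  back the quasidihedral presentation.\<close>

definition qd_rels :: "nat \<Rightarrow> nat \<Rightarrow> (qd_gen letter list \<times> qd_gen letter list) set" where
  "qd_rels N s =
     {(replicate N (Gen QD_a), []),
      ([Gen QD_b, Gen QD_b], []),
      ([Gen QD_b, Gen QD_a, Inv QD_b], replicate s (Gen QD_a))}"

fun normal_word :: "nat \<times> bool \<Rightarrow> qd_gen letter list" where
  "normal_word (x, e) = replicate x (Gen QD_a) @ (if e then [Gen QD_b] else [])"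

text \<open>The product of \<open>a^x b^e\<close> and \<open>a^y b^f\<close> in a semidirect product
  of Z/N by Z/2, read off from \<open>b a^y = a^(s y) b\<close>; \<open>e \<noteq> f\<close> is
  addition modulo 2.\<close>

fun metacyclic_mult :: "nat \<Rightarrow> nat \<Rightarrow> nat \<times> bool \<Rightarrow> nat \<times> bool \<Rightarrow> nat \<times> bool" where
  "metacyclic_mult N s (x, e) (y, f) = ((x + (if e then s * y else y)) mod N, e \<noteq> f)"

section \<open>The action of words on normal forms\<close>

context
  fixes N s :: nat
  assumes N: "0 < N" and ss: "s * s mod N = 1 mod N"
begin

text \<open>Left multiplication by a letter on the normal form \<open>a\<^sup>x b\<^sup>e\<close>, encoded as \<open>(x, e)\<close>.\<close>

fun letter_act :: "qd_gen letter \<Rightarrow> nat \<times> bool \<Rightarrow> nat \<times> bool" where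
  "letter_act (Gen QD_a) (x, e) = (Suc x mod N, e)"
| "letter_act (Inv QD_a) (x, e) = ((x + (N - 1)) mod N, e)"
| "letter_act (Gen QD_b) (x, e) = (s * x mod N, \<not> e)"
| "letter_act (Inv QD_b) (x, e) = (s * x mod N, \<not> e)"

abbreviation word_act :: "qd_gen letter list \<Rightarrow> nat \<times> bool \<Rightarrow> nat \<times> bool" where
  "word_act \<equiv> foldr letter_act"

lemma letter_act_closed: "fst (letter_act l p) < N"
  using N by (induction l p rule: letter_act.induct) auto

lemma word_act_closed: "fst p < N \<Longrightarrow> fst (word_act w p) < N"
  by (cases w) (auto simp: letter_act_closed)

lemma funpow_letter_act_a: "x < N \<Longrightarrow> (letter_act (Gen QD_a) ^^ k) (x, e) = ((x + k) mod N, e)"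
  by (induction k) (auto simp: mod_Suc_eq)

text \<open>The assumption \<open>ss\<close> enters here: it makes \<open>b\<close> act as an
  involution, as the relation \<open>b b = 1\<close> demands.\<close>

lemma s_act_twice: "s * (s * x mod N) mod N = x mod N"
  by (metis mod_mult_left_eq mod_mult_right_eq mult.assoc mult.left_neutral ss)

text \<open>In each rule the suffix \<open>v\<close> first carries \<open>p\<close> to some
  \<open>(y, e)\<close>; the two sides of the rule act equally there, and the prefix
  \<open>u\<close> follows. The bound on \<open>fst p\<close> matters because \<open>a a^-1\<close>
  only returns \<open>y mod N\<close>.\<close>

lemma word_act_cong:
  "word_eq (qd_rels N s) v w \<Longrightarrow> fst p < N \<Longrightarrow> word_act v p = word_act w p"
proof (induction arbitrary: p rule: word_eq.induct)
  case (cancel_right u x v)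
  obtain y e where y: "word_act v p = (y, e)" "y < N"
    using word_act_closed[OF cancel_right, of v] by (cases "word_act v p") auto
  have "letter_act (Gen x) (letter_act (Inv x) (y, e)) = (y, e)"
    using y(2) N by (cases x) (auto simp: s_act_twice mod_Suc_eq simp flip: add_Suc_right)
  then show ?case by (simp add: y)
next
  case (cancel_left u x v)
  obtain y e where y: "word_act v p = (y, e)" "y < N"
    using word_act_closed[OF cancel_left, of v] by (cases "word_act v p") auto
  have "(Suc y mod N + (N - 1)) mod N = y"
    using y(2) N mod_add_left_eq[of "Suc y" N "N - 1"] by simp
  then have "letter_act (Inv x) (letter_act (Gen x) (y, e)) = (y, e)"
    using y(2) by (cases x) (auto simp: s_act_twice)
  then show ?case by (simp add: y)
next
  case (relation l r u v)
  obtain y e where y: "word_act v p = (y, e)" "y < N"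
    using word_act_closed[OF relation(2), of v] by (cases "word_act v p") auto
  \<comment> \<open>The word \<open>b a b^-1\<close> takes \<open>y\<close> to
    \<open>s (s y + 1)\<close>, which is \<open>y + s\<close> modulo \<open>N\<close> because
    \<open>s\<close> is its own inverse there.\<close>
  have "s * (Suc (s * y mod N) mod N) mod N = (s * Suc (s * y mod N)) mod N"
    by (simp add: mod_mult_right_eq)
  also have "\<dots> = (s + s * (s * y mod N) mod N) mod N"
    by (simp add: mod_add_right_eq)
  finally have "s * (Suc (s * y mod N) mod N) mod N = (y + s) mod N"
    by (simp add: s_act_twice mod_add_right_eq add.commute)
  then have "word_act l (y, e) = word_act r (y, e)"
    using relation(1) y(2) by (auto simp: qd_rels_def funpow_letter_act_a s_act_twice)
  then show ?case by (simp add: y)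
qed auto

text \<open>\<open>(0, False)\<close> encodes the identity, so evaluating the action there recovers
  the exponents. With \<open>word_act_cong\<close> this separates normal words.\<close>

lemma word_act_normal_word: "fst p < N \<Longrightarrow> word_act (normal_word p) (0, False) = p"
  using N by (cases p) (auto simp: funpow_letter_act_a)

section \<open>Rewriting words to normal form\<close>

lemma word_eq_replicate_mod:
  "word_eq (qd_rels N s) (replicate k (Gen QD_a) @ w) (replicate (k mod N) (Gen QD_a) @ w)"
proof (induction k rule: less_induct)
  case (less k)
  show ?case
  proof (cases "k < N")
    case False
    then have "replicate k (Gen QD_a) @ w = replicate N (Gen QD_a) @ replicate (k - N) (Gen QD_a) @ w"
      by (simp flip: append_assoc replicate_add)
    moreover have "word_eq (qd_rels N s) \<dots> (replicate (k - N) (Gen QD_a) @ w)"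
      using word_eq.relation[of "replicate N (Gen QD_a)" "[]" "qd_rels N s" "[]"]
      by (simp add: qd_rels_def)
    ultimately show ?thesis
      using less[of "k - N"] False N by (auto simp: le_mod_geq intro: word_eq.trans)
  qed (simp add: word_eq.refl)
qed

text \<open>Inserting \<open>b^-1 b\<close> behind \<open>b a\<close> exposes the left side of the
  relation for \<open>b a b^-1\<close>, which yields a rule moving \<open>b\<close> to the
  right.\<close>

lemma word_eq_b_a:
  "word_eq (qd_rels N s) (Gen QD_b # Gen QD_a # w) (replicate s (Gen QD_a) @ Gen QD_b # w)"
proof -
  have "word_eq (qd_rels N s) ([Gen QD_b, Gen QD_a] @ w) ([Gen QD_b, Gen QD_a] @ [Inv QD_b, Gen QD_b] @ w)"
    by (rule word_eq.sym[OF word_eq.cancel_left])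
  moreover have "word_eq (qd_rels N s) ([] @ [Gen QD_b, Gen QD_a, Inv QD_b] @ Gen QD_b # w)
      ([] @ replicate s (Gen QD_a) @ Gen QD_b # w)"
    by (rule word_eq.relation) (simp add: qd_rels_def)
  ultimately show ?thesis by (auto intro: word_eq.trans)
qed

lemma word_eq_b_replicate_a:
  "word_eq (qd_rels N s) (Gen QD_b # replicate k (Gen QD_a) @ w)
     (replicate (s * k) (Gen QD_a) @ Gen QD_b # w)"
proof (induction k)
  case (Suc k)
  have "word_eq (qd_rels N s) (replicate s (Gen QD_a) @ (Gen QD_b # replicate k (Gen QD_a) @ w) @ [])
      (replicate s (Gen QD_a) @ (replicate (s * k) (Gen QD_a) @ Gen QD_b # w) @ [])"
    using Suc by (rule word_eq_append_context)
  then have "word_eq (qd_rels N s) (replicate s (Gen QD_a) @ Gen QD_b # replicate k (Gen QD_a) @ w)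
      (replicate (s * Suc k) (Gen QD_a) @ Gen QD_b # w)"
    by (simp add: replicate_add)
  with word_eq_b_a[of "replicate k (Gen QD_a) @ w"] show ?case
    by (auto intro: word_eq.trans)
qed (simp add: word_eq.refl)

lemma word_eq_Gen_b_normal_word:
  "word_eq (qd_rels N s) (Gen QD_b # normal_word p) (normal_word (letter_act (Gen QD_b) p))"
proof -
  obtain x e where p: "p = (x, e)" by (cases p)
  have "word_eq (qd_rels N s) (Gen QD_b # normal_word p)
      (replicate (s * x mod N) (Gen QD_a) @ Gen QD_b # (if e then [Gen QD_b] else []))"
    unfolding p normal_word.simps
    by (rule word_eq.trans[OF word_eq_b_replicate_a word_eq_replicate_mod])
  moreover have "word_eq (qd_rels N s) (replicate y (Gen QD_a) @ [Gen QD_b, Gen QD_b] @ [])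
      (replicate y (Gen QD_a) @ [] @ [])" for y
    by (rule word_eq.relation) (simp add: qd_rels_def)
  ultimately show ?thesis
    by (cases e) (auto simp: p intro: word_eq.trans)
qed

lemma word_eq_letter_normal_word:
  assumes "fst p < N"
  shows "word_eq (qd_rels N s) (l # normal_word p) (normal_word (letter_act l p))"
proof -
  obtain x e where p: "p = (x, e)" by (cases p)
  define t where "t = (if e then [Gen QD_b] else [])"
  consider "l = Gen QD_a" | "l = Inv QD_a" | "l = Gen QD_b" | "l = Inv QD_b"
    by (metis letter.exhaust qd_gen.exhaust)
  then show ?thesis
  proof cases
    case 1
    then show ?thesis using word_eq_replicate_mod[of "Suc x" t] by (simp add: p t_def)
  next
    case 2
    \<comment> \<open>For \<open>x = 0\<close> there is no \<open>a\<close> to cancel against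
      \<open>a^-1\<close>, so \<open>a^N\<close> is inserted first; the cancellation then leaves
      exponent \<open>x + (N - 1)\<close>.\<close>
    have "word_eq (qd_rels N s) (replicate (N + x) (Gen QD_a) @ t) (replicate x (Gen QD_a) @ t)"
      using word_eq_replicate_mod[of "N + x" t] assms by (simp add: p)
    from word_eq_append_context[OF word_eq.sym[OF this], of "[Inv QD_a]" "[]"]
    have "word_eq (qd_rels N s) (Inv QD_a # replicate x (Gen QD_a) @ t)
        (Inv QD_a # replicate (N + x) (Gen QD_a) @ t)" by simp
    also have "Inv QD_a # replicate (N + x) (Gen QD_a) @ t
        = [] @ [Inv QD_a, Gen QD_a] @ (replicate (x + (N - 1)) (Gen QD_a) @ t)"
      using N by (cases N) (auto simp: add.commute)
    also have "word_eq (qd_rels N s) \<dots> ([] @ replicate (x + (N - 1)) (Gen QD_a) @ t)"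
      by (rule word_eq.cancel_left)
    also (word_eq.trans) have "word_eq (qd_rels N s) \<dots> (replicate ((x + (N - 1)) mod N) (Gen QD_a) @ t)"
      unfolding append_Nil by (rule word_eq_replicate_mod)
    finally (word_eq.trans) show ?thesis using 2 by (simp add: p t_def)
  next
    case 3
    then show ?thesis using word_eq_Gen_b_normal_word by simp
  next
    case 4
    \<comment> \<open>Inserting \<open>b b\<close> and cancelling \<open>b^-1 b\<close> replaces
      \<open>b^-1\<close> by \<open>b\<close>, which reduces this case to the previous one.\<close>
    have "word_eq (qd_rels N s) ([Inv QD_b] @ [] @ normal_word p) ([Inv QD_b] @ [Gen QD_b, Gen QD_b] @ normal_word p)"
      by (rule word_eq.sym[OF word_eq.relation]) (simp add: qd_rels_def)
    moreover have "word_eq (qd_rels N s) ([] @ [Inv QD_b, Gen QD_b] @ Gen QD_b # normal_word p) ([] @ Gen QD_b # normal_word p)"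
      by (rule word_eq.cancel_left)
    ultimately have "word_eq (qd_rels N s) (Inv QD_b # normal_word p) (Gen QD_b # normal_word p)"
      by (auto intro: word_eq.trans)
    moreover have "letter_act (Inv QD_b) p = letter_act (Gen QD_b) p" by (simp add: p)
    ultimately show ?thesis
      using 4 word_eq_Gen_b_normal_word[of p] by (auto intro: word_eq.trans)
  qed
qed

text \<open>The letters of \<open>w\<close> are absorbed into the normal word one by one, the last
  letter first, so rewriting follows the action.\<close>

lemma word_eq_normal_word:
  assumes "fst p < N"
  shows "word_eq (qd_rels N s) (w @ normal_word p) (normal_word (word_act w p))"
proof (induction w)
  case (Cons l w)
  from word_eq_append_context[OF Cons, of "[l]" "[]"]
  have "word_eq (qd_rels N s) (l # w @ normal_word p) (l # normal_word (word_act w p))" by simp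
  with word_eq_letter_normal_word[OF word_act_closed[OF assms]] show ?case
    by (auto intro: word_eq.trans)
qed (simp add: word_eq.refl)

section \<open>The multiplication table of the presented group\<close>

definition normal_class :: "nat \<times> bool \<Rightarrow> qd_gen letter list set" where
  "normal_class p = word_rel (qd_rels N s) `` {normal_word p}"

lemma bij_normal_class:
  "bij_betw normal_class ({..<N} \<times> UNIV) (carrier (presented_group (qd_rels N s)))"
proof (rule bij_betwI')
  fix p q assume "p \<in> {..<N} \<times> (UNIV :: bool set)" "q \<in> {..<N} \<times> (UNIV :: bool set)"
  then have "p = q" if "word_eq (qd_rels N s) (normal_word p) (normal_word q)"
    using word_act_cong[OF that, of "(0, False)"] N word_act_normal_word[of p] word_act_normal_word[of q]
    by auto
  then show "normal_class p = normal_class q \<longleftrightarrow> p = q"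
    by (auto simp: normal_class_def word_class_eq_iff intro: word_eq.refl)
next
  fix U assume "U \<in> carrier (presented_group (qd_rels N s))"
  then obtain w where w: "U = word_rel (qd_rels N s) `` {w}"
    by (auto simp: presented_group_def quotient_def)
  \<comment> \<open>\<open>normal_word (0, False)\<close> is empty, so reducing \<open>w\<close>
    followed by it reduces \<open>w\<close> itself.\<close>
  define p where "p = word_act w (0, False)"
  have "word_eq (qd_rels N s) w (normal_word p)"
    using word_eq_normal_word[of "(0, False)" w] N by (simp add: p_def)
  then have "U = normal_class p" by (simp add: w normal_class_def word_class_eq_iff)
  moreover have "p \<in> {..<N} \<times> UNIV"
    using word_act_closed[of "(0, False)" w] N by (cases p) (simp add: p_def)
  ultimately show "\<exists>p\<in>{..<N} \<times> UNIV. U = normal_class p" by blast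
qed (auto simp: normal_class_def presented_group_def quotient_def)

text \<open>Letting the word of \<open>p\<close> act on \<open>q\<close> is multiplication of normal
  forms, and rewriting brings the concatenated word to the result.\<close>

lemma normal_class_mult:
  assumes "fst p < N" "fst q < N"
  shows "normal_class p \<otimes>\<^bsub>presented_group (qd_rels N s)\<^esub> normal_class q
    = normal_class (metacyclic_mult N s p q)"
proof -
  have "word_act (normal_word p) q = metacyclic_mult N s p q"
    using assms N by (cases p; cases q)
      (auto simp: funpow_letter_act_a mod_add_right_eq add.commute)
  then show ?thesis
    using word_eq_normal_word[OF assms(2), of "normal_word p"]
    by (simp add: normal_class_def presented_group_mult word_class_eq_iff)
qed

end

section \<open>Commuting classes\<close>

context
  fixes K :: nat
  assumes K: "even K" "0 < K"
begin

abbreviation qd_mult :: "nat \<times> bool \<Rightarrow> nat \<times> bool \<Rightarrow> nat \<times> bool" where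
  "qd_mult \<equiv> metacyclic_mult (4 * K) (2 * K - 1)"

text \<open>The factor \<open>2K - 2\<close> is \<open>s - 1\<close> for \<open>s = 2K - 1\<close>.
  After a factor 2 is cancelled, \<open>K - 1\<close> is odd because \<open>K\<close> is even, and
  coprime to its neighbour \<open>K\<close>, so it can be cancelled too.\<close>

lemma four_K_dvd_iff: "int (4 * K) dvd (2 * int K - 2) * z \<longleftrightarrow> int (2 * K) dvd z"
proof -
  have "coprime (2 :: int) (int K - 1)"
    using K by (simp add: coprime_left_2_iff_odd)
  moreover have "coprime (int K) (int K - 1)"
    by (simp add: coprime_commute[of "int K"] coprime_diff_one_left)
  ultimately have "coprime (int (2 * K)) (int K - 1)"
    by (simp add: coprime_mult_left_iff)
  then have "int (2 * K) dvd (int K - 1) * z \<longleftrightarrow> int (2 * K) dvd z"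
    by (rule coprime_dvd_mult_right_iff)
  moreover have "int (4 * K) = 2 * int (2 * K)" "(2 * int K - 2) * z = 2 * ((int K - 1) * z)"
    by (simp_all add: algebra_simps)
  ultimately show ?thesis by (simp only: dvd_mult_cancel_left) simp
qed

lemma mod_four_K_eq_iff: "a mod (4 * K) = b mod (4 * K) \<longleftrightarrow> int (4 * K) dvd int a - int b"
  by (metis mod_eq_dvd_iff of_nat_eq_iff of_nat_mod)

lemma mult_commute_rotations: "qd_mult (x, False) (y, False) = qd_mult (y, False) (x, False)"
  by (simp add: add.commute)

text \<open>The two products have exponents \<open>x + y\<close> and \<open>y + s x\<close>, which
  differ by \<open>(s - 1) x\<close>.\<close>

lemma mult_commute_rotation_reflection:
  "qd_mult (x, False) (y, True) = qd_mult (y, True) (x, False) \<longleftrightarrow> 2 * K dvd x"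
proof -
  have "int (y + (2 * K - 1) * x) - int (x + y) = (2 * int K - 2) * int x"
    using K by (cases K) (simp_all add: algebra_simps)
  then show ?thesis
    using four_K_dvd_iff[of "int x"] mod_four_K_eq_iff[of "y + (2 * K - 1) * x" "x + y"]
    by (auto simp: int_dvd_int_iff simp del: of_nat_mult of_nat_add)
qed

text \<open>The exponents \<open>y + s x\<close> and \<open>x + s y\<close> differ by
  \<open>(s - 1) (x - y)\<close>, a difference taken in the integers to avoid truncation.\<close>

lemma mult_commute_reflections:
  "qd_mult (x, True) (y, True) = qd_mult (y, True) (x, True) \<longleftrightarrow> x mod (2 * K) = y mod (2 * K)"
proof -
  have "int (y + (2 * K - 1) * x) - int (x + (2 * K - 1) * y) = (2 * int K - 2) * (int x - int y)"
    using K by (cases K) (simp_all add: algebra_simps)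
  then have "qd_mult (x, True) (y, True) = qd_mult (y, True) (x, True) \<longleftrightarrow> int (2 * K) dvd int x - int y"
    using four_K_dvd_iff[of "int x - int y"] mod_four_K_eq_iff[of "y + (2 * K - 1) * x" "x + (2 * K - 1) * y"]
    by (auto simp del: of_nat_mult of_nat_add)
  also have "\<dots> \<longleftrightarrow> x mod (2 * K) = y mod (2 * K)"
    by (metis mod_eq_dvd_iff of_nat_eq_iff of_nat_mod)
  finally show ?thesis .
qed

text \<open>The first block leaves out the central exponents 0 and \<open>2K\<close>; each other
  block joins \<open>a^x b\<close> with its multiple by the central \<open>a^(2K)\<close>.\<close>

definition noncentral_cliques :: "(nat \<times> bool) list list" where
  "noncentral_cliques =
     map (\<lambda>x. (x, False)) ([1..<2 * K] @ [2 * K + 1..<4 * K])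
     # map (\<lambda>x. [(x, True), (x + 2 * K, True)]) [0..<2 * K]"

lemma distinct_noncentral_cliques: "distinct (concat noncentral_cliques)"
proof -
  \<comment> \<open>Induction over the upper end; the bound \<open>2K\<close> keeps a new exponent
    from meeting an earlier \<open>x + 2K\<close>.\<close>
  have "distinct (concat (map (\<lambda>x. [(x, True), (x + 2 * K, True)]) [0..<k]))" if "k \<le> 2 * K" for k
    using that K by (induction k) auto
  from this[OF order.refl] show ?thesis
    by (auto simp: noncentral_cliques_def distinct_map inj_on_def)
qed

lemma mem_noncentral_cliques:
  "(x, e) \<in> set (concat noncentral_cliques) \<longleftrightarrow> x < 4 * K \<and> (e \<or> \<not> 2 * K dvd x)"
proof (cases e)
  case True
  have "x \<in> {..<2 * K} \<or> (\<exists>y<2 * K. x = y + 2 * K) \<longleftrightarrow> x < 4 * K"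
    by (auto intro: exI[of _ "x - 2 * K"])
  then show ?thesis using True by (auto simp: noncentral_cliques_def)
next
  case False
  have "2 * K dvd x \<longleftrightarrow> x = 0 \<or> x = 2 * K" if "x < 4 * K"
  proof
    assume "2 * K dvd x"
    then obtain c where c: "x = 2 * K * c" ..
    with that have "c < 2" by simp
    then show "x = 0 \<or> x = 2 * K" using c by (auto simp: less_2_cases_iff)
  qed auto
  then show ?thesis using False K by (auto simp: noncentral_cliques_def image_iff)
qed

text \<open>The generators witness noncentrality: \<open>a\<close> fails to commute with every
  \<open>a^x b\<close>, and \<open>b\<close> with every \<open>a^x\<close> for which
  \<open>2K\<close> does not divide \<open>x\<close>.\<close>

lemma set_noncentral_cliques:
  "set (concat noncentral_cliques)
    = {p \<in> {..<4 * K} \<times> UNIV. \<exists>q\<in>{..<4 * K} \<times> UNIV. qd_mult p q \<noteq> qd_mult q p}"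
proof (rule Set.set_eqI)
  fix p :: "nat \<times> bool"
  obtain x e where p: "p = (x, e)" by (cases p)
  have *: "\<not> 2 * K dvd 1" using K by simp
  have "(\<exists>q\<in>{..<4 * K} \<times> UNIV. qd_mult p q \<noteq> qd_mult q p) \<longleftrightarrow> e \<or> \<not> 2 * K dvd x"
  proof (cases e)
    case True
    then have "qd_mult p (1, False) \<noteq> qd_mult (1, False) p"
      using mult_commute_rotation_reflection[of 1 x] * unfolding p by metis
    then show ?thesis using True K by (auto intro!: bexI[of _ "(1, False)"])
  next
    case False
    have "qd_mult p q = qd_mult q p" if "2 * K dvd x" for q
      using that False mult_commute_rotation_reflection[of x] mult_commute_rotations[of x]
      unfolding p by (metis (full_types) surj_pair)
    moreover have "qd_mult p (0, True) \<noteq> qd_mult (0, True) p" if "\<not> 2 * K dvd x"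
      using that False mult_commute_rotation_reflection[of x 0] unfolding p by simp
    moreover have "(0, True) \<in> {..<4 * K} \<times> UNIV" using K by simp
    ultimately show ?thesis using False by blast
  qed
  then show "p \<in> set (concat noncentral_cliques)
      \<longleftrightarrow> p \<in> {p \<in> {..<4 * K} \<times> UNIV. \<exists>q\<in>{..<4 * K} \<times> UNIV. qd_mult p q \<noteq> qd_mult q p}"
    using mem_noncentral_cliques[of x e] unfolding p by simp
qed

text \<open>On noncentral elements commuting is an equivalence relation with the blocks as classes.
  A rotation and a reflection commute only if \<open>2K\<close> divides the exponent of the
  rotation, which noncentrality excludes.\<close>

lemma mult_commute_iff_noncentral_cliques:
  assumes "p \<in> set (concat noncentral_cliques)" "q \<in> set (concat noncentral_cliques)"
  shows "qd_mult p q = qd_mult q p \<longleftrightarrow> (\<exists>W\<in>set noncentral_cliques. p \<in> set W \<and> q \<in> set W)"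
proof -
  obtain x e y f where pq: "p = (x, e)" "q = (y, f)" by (cases p, cases q)
  have lt: "x < 4 * K" "y < 4 * K" and dvd: "e \<or> \<not> 2 * K dvd x" "f \<or> \<not> 2 * K dvd y"
    using assms unfolding pq mem_noncentral_cliques by auto
  \<comment> \<open>Below \<open>4K\<close> a residue class modulo \<open>2K\<close> consists of
    some \<open>z\<close> and \<open>z + 2K\<close>, which is exactly a block of
    reflections.\<close>
  have reflections: "x mod (2 * K) = y mod (2 * K) \<longleftrightarrow>
      (\<exists>z<2 * K. (x = z \<or> x = z + 2 * K) \<and> (y = z \<or> y = z + 2 * K))"
  proof
    assume *: "x mod (2 * K) = y mod (2 * K)"
    have "z = z mod (2 * K) \<or> z = z mod (2 * K) + 2 * K" if "z < 4 * K" for z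
      using that K by (cases "z < 2 * K") (auto simp: le_mod_geq)
    from this[OF lt(1)] this[OF lt(2)] show "\<exists>z<2 * K. (x = z \<or> x = z + 2 * K) \<and> (y = z \<or> y = z + 2 * K)"
      using * K by (intro exI[of _ "x mod (2 * K)"]) auto
  qed auto
  have False_mem: "(z, False) \<in> set W \<longleftrightarrow> W = hd noncentral_cliques"
    if "z \<in> {x, y}" "\<not> 2 * K dvd z" "W \<in> set noncentral_cliques" for z W
    using that lt mem_noncentral_cliques[of z False] by (auto simp: noncentral_cliques_def)
  show ?thesis
  proof (cases "e \<and> f")
    case True
    then show ?thesis
      unfolding pq using mult_commute_reflections[of x y] reflections
      by (auto simp: noncentral_cliques_def simp del: metacyclic_mult.simps)
  next
    case notboth: False
    have hd: "hd noncentral_cliques \<in> set noncentral_cliques" and True_mem: "(z, True) \<notin> set (hd noncentral_cliques)" for z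
      by (auto simp: noncentral_cliques_def)
    show ?thesis
    proof (cases "e = f")
      case True
      then show ?thesis
        using notboth dvd hd False_mem mult_commute_rotations[of x y] unfolding pq by auto
    next
      case False
      then have "\<not> (\<exists>W\<in>set noncentral_cliques. p \<in> set W \<and> q \<in> set W)"
        using dvd True_mem False_mem unfolding pq by (cases e) auto
      moreover have "qd_mult p q \<noteq> qd_mult q p"
        using False notboth dvd mult_commute_rotation_reflection[of x y] mult_commute_rotation_reflection[of y x]
        unfolding pq by (cases e) (auto simp del: metacyclic_mult.simps)
      ultimately show ?thesis by simp
    qed
  qed
qed

text \<open>The bijection \<open>h\<close> transports products, hence also commutation and the
  center, so the graph is the union of the images of the blocks. The large clique has
  \<open>4K - 2\<close> vertices and gives \<open>2 (4K - 3) = 8K - 6\<close> in the signless case;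
  each of the \<open>2K\<close> edges gives 0 and 2 in both spectra.\<close>

lemma spectra_commuting_graph:
  fixes G :: "('a, 'm) monoid_scheme"
  assumes bij: "bij_betw h ({..<4 * K} \<times> UNIV) (carrier G)"
    and mult: "\<And>p q. p \<in> {..<4 * K} \<times> UNIV \<Longrightarrow> q \<in> {..<4 * K} \<times> UNIV \<Longrightarrow>
      h p \<otimes>\<^bsub>G\<^esub> h q = h (qd_mult p q)"
  shows "L_Spec (commuting_graph G) = replicate_mset (2 * K + 1) 0
      + replicate_mset (4 * K - 3) (of_nat (4 * K - 2)) + replicate_mset (2 * K) 2"
    and "Q_Spec (commuting_graph G) = {#of_nat (8 * K - 6)#}
      + replicate_mset (4 * K - 3) (of_nat (4 * K - 4)) + replicate_mset (2 * K) 2 + replicate_mset (2 * K) 0"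
proof -
  let ?X = "{..<4 * K} \<times> (UNIV :: bool set)"
  define Vs where "Vs = map (map h) noncentral_cliques"
  have closed: "qd_mult p q \<in> ?X" if "p \<in> ?X" "q \<in> ?X" for p q
    using that K by (cases p; cases q) auto
  have inj: "inj_on h ?X" and img: "h ` ?X = carrier G"
    using bij by (auto simp: bij_betw_def)
  have commute: "h p \<otimes>\<^bsub>G\<^esub> h q = h q \<otimes>\<^bsub>G\<^esub> h p \<longleftrightarrow> qd_mult p q = qd_mult q p" if "p \<in> ?X" "q \<in> ?X" for p q
    using inj_on_eq_iff[OF inj closed[OF that] closed[OF that(2,1)]] mult that by simp
  have sub: "set (concat noncentral_cliques) \<subseteq> ?X"
    unfolding set_noncentral_cliques by auto
  have noncentral: "carrier G - group_center G = h ` set (concat noncentral_cliques)"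
  proof -
    have "h p \<in> group_center G \<longleftrightarrow> (\<forall>q\<in>?X. qd_mult p q = qd_mult q p)" if "p \<in> ?X" for p
      using that commute[OF that] unfolding group_center_def img[symmetric] by blast
    then show ?thesis
      unfolding set_noncentral_cliques img[symmetric] by blast
  qed
  have concat: "concat Vs = map h (concat noncentral_cliques)"
    by (simp add: Vs_def map_concat)
  have dist: "distinct (concat Vs)"
    unfolding concat distinct_map
    using distinct_noncentral_cliques inj_on_subset[OF inj sub] by blast
  have ne: "[] \<notin> set Vs"
    using K by (auto simp: Vs_def noncentral_cliques_def)
  have verts: "set (concat Vs) = pverts (commuting_graph G)"
    unfolding concat by (simp add: commuting_graph_def noncentral)
  have same_clique: "(\<exists>V\<in>set Vs. h p \<in> set V \<and> h q \<in> set V) \<longleftrightarrow>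
      (\<exists>W\<in>set noncentral_cliques. p \<in> set W \<and> q \<in> set W)"
    if "p \<in> set (concat noncentral_cliques)" "q \<in> set (concat noncentral_cliques)" for p q
  proof -
    have "h r \<in> h ` set W \<longleftrightarrow> r \<in> set W"
      if "r \<in> set (concat noncentral_cliques)" "W \<in> set noncentral_cliques" for r W
      using that sub by (intro inj_on_image_mem_iff[OF inj]) auto
    then show ?thesis using that by (simp add: Vs_def)
  qed
  have arcs: "parcs (commuting_graph G) = {(x, y). x \<noteq> y \<and> (\<exists>V\<in>set Vs. x \<in> set V \<and> y \<in> set V)}"
  proof -
    have "(x, y) \<in> parcs (commuting_graph G) \<longleftrightarrow> x \<noteq> y \<and> (\<exists>V\<in>set Vs. x \<in> set V \<and> y \<in> set V)" for x y
    proof (cases "x \<in> set (concat Vs) \<and> y \<in> set (concat Vs)")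
      case True
      then obtain p q where pq: "p \<in> set (concat noncentral_cliques)" "q \<in> set (concat noncentral_cliques)"
        "x = h p" "y = h q" unfolding concat set_map by (elim conjE imageE)
      then show ?thesis
        using same_clique[OF pq(1,2)] mult_commute_iff_noncentral_cliques[OF pq(1,2)] commute[of p q] sub
        by (auto simp: commuting_graph_def noncentral)
    next
      case False
      then show ?thesis
        using verts by (auto simp: commuting_graph_def)
    qed
    then show ?thesis by auto
  qed
  have sum_map: "(\<Sum>x\<leftarrow>[0..<k]. {#a, b#}) = replicate_mset k a + replicate_mset k b" for k and a b :: complex
    by (induction k) auto
  \<comment> \<open>Being even and positive, \<open>K\<close> is at least 2; writing it as
    \<open>j + 2\<close> turns truncated differences such as \<open>8K - 6\<close> into
    sums.\<close>
  obtain j where j: "K = Suc (Suc j)" using K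
    by (metis even_Suc gr0_implies_Suc not0_implies_Suc even_zero)
  show "L_Spec (commuting_graph G) = replicate_mset (2 * K + 1) 0
      + replicate_mset (4 * K - 3) (of_nat (4 * K - 2)) + replicate_mset (2 * K) 2"
    unfolding L_Spec_disjoint_cliques[OF dist ne verts arcs] Vs_def noncentral_cliques_def
    by (simp add: o_def sum_map j add.commute del: upt_Suc)
  show "Q_Spec (commuting_graph G) = {#of_nat (8 * K - 6)#}
      + replicate_mset (4 * K - 3) (of_nat (4 * K - 4)) + replicate_mset (2 * K) 2 + replicate_mset (2 * K) 0"
    unfolding Q_Spec_disjoint_cliques[OF dist ne verts arcs] Vs_def noncentral_cliques_def
    by (simp add: o_def sum_map j add.commute del: upt_Suc)
qed

end

section \<open>The quasidihedral group of order 2^n\<close>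

theorem proposition2p10:
  fixes n :: nat and G :: "('a, 'm) monoid_scheme"
  assumes "n \<ge> 4"
    and "group G"
    and "G \<cong> quasidihedral_group n"
  shows "L_Spec (commuting_graph G) =
           replicate_mset (2 ^ (n - 2) + 1) 0
         + replicate_mset (2 ^ (n - 1) - 3) (2 ^ (n - 1) - 2)
         + replicate_mset (2 ^ (n - 2)) 2 \<and>
         Q_Spec (commuting_graph G) =
           replicate_mset 1 (2 ^ n - 6)
         + replicate_mset (2 ^ (n - 1) - 3) (2 ^ (n - 1) - 4)
         + replicate_mset (2 ^ (n - 2)) 2
         + replicate_mset (2 ^ (n - 2)) 0"
proof -
  obtain m where n: "n = m + 4"
    using assms(1) by (metis add.commute le_Suc_ex)
  \<comment> \<open>This is \<open>2 ^ (n - 3)\<close>; the bound on \<open>n\<close> makes the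
    exponent positive and hence \<open>K\<close> even.\<close>
  define K :: nat where "K = 2 ^ (m + 1)"
  have K: "even K" "0 < K" by (simp_all add: K_def)
  have pow: "2 ^ (n - 2) = 2 * K" "2 ^ (n - 1) = 4 * K"
    by (simp_all add: n K_def eval_nat_numeral)
  \<comment> \<open>Multiplicities are natural numbers but eigenvalues are complex, so the powers
    are needed in both types.\<close>
  have pow_complex: "(2 :: complex) ^ (n - 1) = 4 * of_nat K" "(2 :: complex) ^ n = 8 * of_nat K"
    by (simp_all add: n K_def eval_nat_numeral)
  let ?N = "4 * K" and ?s = "2 * K - 1"
  \<comment> \<open>Expanding, \<open>(2K - 1)^2 = 4K^2 - 4K + 1\<close>, so \<open>s\<close>
    squares to 1 modulo \<open>4K\<close>.\<close>
  have "?s * ?s = 1 + ?N * (K - 1)"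
    using K by (cases K) (auto simp: algebra_simps)
  then have ss: "?s * ?s mod ?N = 1 mod ?N" by (simp only: mod_mult_self2)
  have N: "0 < ?N" using K by simp
  define H where "H = presented_group (qd_rels ?N ?s)"
  have "quasidihedral_group n = H"
    unfolding quasidihedral_group_def H_def qd_rels_def pow ..
  \<comment> \<open>The given isomorphism is inverted so that normal forms can be mapped into
    \<open>G\<close>.\<close>
  then obtain g where g: "g \<in> iso H G"
    using group.iso_sym[OF assms(2,3)] by (auto simp: is_iso_def)
  define h where "h = g \<circ> normal_class ?N ?s"
  have bij_g: "bij_betw g (carrier H) (carrier G)" and hom: "g \<in> hom H G"
    using g by (auto simp: iso_def)
  have bij: "bij_betw (normal_class ?N ?s) ({..<?N} \<times> UNIV) (carrier H)"
    unfolding H_def by (rule bij_normal_class[OF N ss])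
  have "bij_betw h ({..<?N} \<times> UNIV) (carrier G)"
    unfolding h_def by (rule bij_betw_trans[OF bij bij_g])
  moreover have "h p \<otimes>\<^bsub>G\<^esub> h q = h (metacyclic_mult ?N ?s p q)"
    if "p \<in> {..<?N} \<times> UNIV" "q \<in> {..<?N} \<times> UNIV" for p q
  proof -
    have "h p \<otimes>\<^bsub>G\<^esub> h q = g (normal_class ?N ?s p \<otimes>\<^bsub>H\<^esub> normal_class ?N ?s q)"
      using hom_mult[OF hom bij_betw_apply[OF bij that(1)] bij_betw_apply[OF bij that(2)]]
      by (simp add: h_def)
    then show ?thesis
      using normal_class_mult[OF N ss, of p q] that by (auto simp: h_def H_def)
  qed
  ultimately show ?thesis
    using spectra_commuting_graph[OF K, of h G] K
    unfolding pow pow_complex by (simp add: of_nat_diff)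
qed

end
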